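(* For any (parametric) Timed Automaton $\mathcal{A}$ whose set of clocks is $X$, there exists an equivalent (parametric) non-resetting test Timed Automaton (nrtTA) $\mathcal{A}'$ whose set of clocks $X'$ has size $|X|+1$.
   Context: Timed words. Let $\Sigma$ be a finite alphabet. A timed $\omega$-word over $\Sigma$ is a pair $(\pi,\tau)$ with $\pi:\mathbb{N}_{>0}\to\Sigma$ and $\tau:\mathbb{N}_{>0}\to\mathbb{R}_{\ge 0}$ such that $\tau(i)<\tau(i+1)$ for all $i>0$; conventionally $\tau(0)=0$. Clocks and constraints. Let $X$ be a finite set of clocks and $P$ a finite set of parameters ($P=\emptyset$ in the non-parametric case). $\Gamma(X)$ is the set of clock constraints $\gamma := x\sim c \mid x\sim \mu \mid \neg\gamma \mid \gamma\wedge\gamma$, where $\sim\in\{<,=\}$, $x\in X$, $c\in\mathbb{N}_{\ge 0}$, $\mu\in P$. A clock valuation is a function $v:X\to\mathbb{R}_{\ge 0}$; for $t\in\mathbb{R}_{\geq 0}$, $(v+t)(x)=v(x)+t$ for all $x\in X$. A parameter evaluation is a map $\mathcal{I}:P\to\mathbb{R}$. $v,\mathcal{I}\models\gamma$ means that $\gamma$ is satisfied when clocks are interpreted by $v$ and parameters by $\mathcal{I}$. (Parametric) Timed Automata. A (parametric) Timed Automaton (TA) is a tuple $\mathcal{A}=(\Sigma,Q,T,q_0,B,P)$ where $Q$ is a finite set of control states, $q_0\in Q$ is the initial state, $B\subseteq Q$ (Büchi condition), and $T\subseteq Q\times Q\times\Gamma(X)\times\Sigma\times 2^X$ is a finite set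 of transitions, written $q\xrightarrow{\gamma,a,S}q'$ ($\gamma$ is the guard, $a$ the letter read, $S$ the set of clocks that are reset). Runs. A configuration is a pair $(q,v)$ with $q\in Q$ and $v$ a clock valuation. A (parametric) run of $\mathcal{A}$ over $(\pi,\tau)$ with parameter evaluation $\mathcal{I}$ is an infinite sequence of configurations $(q_{i_0},v_0)(q_{i_1},v_1)(q_{i_2},v_2)\dots$ such that $q_{i_0}=q_0$; there is a sequence of transitions $q_{i_0}\xrightarrow{\gamma_1,\pi(1),S_1}q_{i_1}\xrightarrow{\gamma_2,\pi(2),S_2}q_{i_2}\dots$ of $T$ with $v_{i-1}+\tau(i)-\tau(i-1),\mathcal{I}\models\gamma_i$ for all $i>0$; and, for all $x\in X$, $v_0(x)=0$ and for all $i>0$, $v_i(x)=0$ if $x\in S_i$ and $v_i(x)=v_{i-1}(x)+\tau(i)-\tau(i-1)$ otherwise. The run is accepting if some state of $B$ occurs in it infinitely often. nrtTA. A (parametric) TA is a (parametric) non-resetting test TA (nrtTA) if, for every transition $q\xrightarrow{\gamma,a,S}q'$ in $T$, no clock occurring in $\gamma$ belongs to $S$. Equivalence. Two (parametric) TA over the same alphabet and the same parameters are equivalent if, for every parameter evaluation $\mathcal{I}$, they have accepting runs with parameter evaluation $\mathcal{I}$ over exactly the same timed $\omega$-words (in the non-parametric case: they accept the same timed $\omega$-words). *)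

theory Defs
  imports Complex_Main "HOL-Library.FuncSet"
begin

datatype rel = Less | Equal

fun rel_holds :: "rel \<Rightarrow> real \<Rightarrow> real \<Rightarrow> bool" where
  "rel_holds Less a b \<longleftrightarrow> a < b"
| "rel_holds Equal a b \<longleftrightarrow> a = b"

datatype (constraint_clocks: 'x, constraint_params: 'p) clock_constraint =
    Cmp_Const 'x rel nat
  | Cmp_Param 'x rel 'p
  | Neg "('x, 'p) clock_constraint"
  | Conj "('x, 'p) clock_constraint" "('x, 'p) clock_constraint"

definition constraints :: "'x set \<Rightarrow> 'p set \<Rightarrow> ('x, 'p) clock_constraint set" where
  "constraints X P = {g. constraint_clocks g \<subseteq> X \<and> constraint_params g \<subseteq> P}"

primrec sat :: "('x \<Rightarrow> real) \<Rightarrow> ('p \<Rightarrow> real) \<Rightarrow> ('x, 'p) clock_constraint \<Rightarrow> bool" where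
  "sat v I (Cmp_Const x r c) \<longleftrightarrow> rel_holds r (v x) (real c)"
| "sat v I (Cmp_Param x r m) \<longleftrightarrow> rel_holds r (v x) (I m)"
| "sat v I (Neg g) \<longleftrightarrow> \<not> sat v I g"
| "sat v I (Conj g h) \<longleftrightarrow> sat v I g \<and> sat v I h"

type_synonym ('a, 'q, 'x, 'p) transition =
  "'q \<times> 'q \<times> ('x, 'p) clock_constraint \<times> 'a \<times> 'x set"

record ('a, 'q, 'x, 'p) ta =
  alphabet :: "'a set"
  clocks :: "'x set"
  states :: "'q set"
  transitions :: "('a, 'q, 'x, 'p) transition set"
  initial :: 'q
  buchi :: "'q set"
  params :: "'p set"

definition timed_automaton :: "('a, 'q, 'x, 'p) ta \<Rightarrow> bool" where
  "timed_automaton A \<longleftrightarrow>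
     finite (alphabet A) \<and> finite (clocks A) \<and> finite (states A) \<and> finite (params A) \<and>
     finite (transitions A) \<and>
     transitions A \<subseteq> states A \<times> states A \<times> constraints (clocks A) (params A) \<times>
                      alphabet A \<times> Pow (clocks A) \<and>
     initial A \<in> states A \<and> buchi A \<subseteq> states A"

definition nrt :: "('a, 'q, 'x, 'p) ta \<Rightarrow> bool" where
  "nrt A \<longleftrightarrow> (\<forall>(q, q', g, a, S) \<in> transitions A. constraint_clocks g \<inter> S = {})"

(* Positions of a word start at 1: the value of \<pi> at 0 is never used, and \<tau> at 0 is 0 by
   convention. The first time stamp may itself be 0. *)
definition timed_word :: "'a set \<Rightarrow> (nat \<Rightarrow> 'a) \<Rightarrow> (nat \<Rightarrow> real) \<Rightarrow> bool" where
  "timed_word \<Sigma> \<pi> \<tau> \<longleftrightarrow>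
     \<tau> 0 = 0 \<and> (\<forall>i>0. \<pi> i \<in> \<Sigma> \<and> 0 \<le> \<tau> i \<and> \<tau> i < \<tau> (i + 1))"

(* Valuations are total functions whose values outside the clock set are irrelevant;
   likewise parameter evaluations outside the parameter set. *)
definition is_run ::
  "('a, 'q, 'x, 'p) ta \<Rightarrow> ('p \<Rightarrow> real) \<Rightarrow> (nat \<Rightarrow> 'a) \<Rightarrow> (nat \<Rightarrow> real) \<Rightarrow>
   (nat \<Rightarrow> 'q \<times> ('x \<Rightarrow> real)) \<Rightarrow> bool" where
  "is_run A I \<pi> \<tau> \<rho> \<longleftrightarrow>
     (let q = (\<lambda>i. fst (\<rho> i)); v = (\<lambda>i. snd (\<rho> i)) in
       (\<forall>i. q i \<in> states A \<and> v i \<in> clocks A \<rightarrow> {0..}) \<and>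
       q 0 = initial A \<and> (\<forall>x \<in> clocks A. v 0 x = 0) \<and>
       (\<exists>g S. \<forall>i>0.
          (q (i - 1), q i, g i, \<pi> i, S i) \<in> transitions A \<and>
          sat (\<lambda>x. v (i - 1) x + (\<tau> i - \<tau> (i - 1))) I (g i) \<and>
          (\<forall>x \<in> clocks A.
             v i x = (if x \<in> S i then 0 else v (i - 1) x + (\<tau> i - \<tau> (i - 1))))))"

definition accepting :: "('a, 'q, 'x, 'p) ta \<Rightarrow> (nat \<Rightarrow> 'q \<times> ('x \<Rightarrow> real)) \<Rightarrow> bool" where
  "accepting A \<rho> \<longleftrightarrow> (\<exists>b \<in> buchi A. infinite {i. fst (\<rho> i) = b})"

definition language ::
  "('a, 'q, 'x, 'p) ta \<Rightarrow> ('p \<Rightarrow> real) \<Rightarrow> ((nat \<Rightarrow> 'a) \<times> (nat \<Rightarrow> real)) set" where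
  "language A I =
     {(\<pi>, \<tau>). timed_word (alphabet A) \<pi> \<tau> \<and> (\<exists>\<rho>. is_run A I \<pi> \<tau> \<rho> \<and> accepting A \<rho>)}"

definition equivalent :: "('a, 'q, 'x, 'p) ta \<Rightarrow> ('a, 'r, 'y, 'p) ta \<Rightarrow> bool" where
  "equivalent A A' \<longleftrightarrow>
     alphabet A = alphabet A' \<and> params A = params A' \<and> (\<forall>I. language A I = language A' I)"

end

theory Submission
  imports Defs "HOL-Library.Countable_Set"
begin

text \<open>
  The values of the clocks in \<open>X\<close> are held by \<open>|X| + 1\<close> registers: each control state also records
  which register holds the value of which clock. At most \<open>|X|\<close> registers are in use at any time, so
  some register is free. Instead of resetting the clocks in \<open>S\<close>, a transition resets one free
  register, which its guard does not mention, and redirects all clocks in \<open>S\<close> to it.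
\<close>

section \<open>Runs as sequences of single steps, and language inclusion by simulation\<close>

definition step ::
  "('a, 'q, 'x, 'p) ta \<Rightarrow> ('p \<Rightarrow> real) \<Rightarrow> 'a \<Rightarrow> real \<Rightarrow>
   'q \<times> ('x \<Rightarrow> real) \<Rightarrow> 'q \<times> ('x \<Rightarrow> real) \<Rightarrow> bool" where
  "step A I a t c c' \<longleftrightarrow>
     (\<exists>g S. (fst c, fst c', g, a, S) \<in> transitions A \<and> sat (\<lambda>x. snd c x + t) I g \<and>
            (\<forall>x \<in> clocks A. snd c' x = (if x \<in> S then 0 else snd c x + t)))"

definition configuration :: "('a, 'q, 'x, 'p) ta \<Rightarrow> 'q \<times> ('x \<Rightarrow> real) \<Rightarrow> bool" where
  "configuration A c \<longleftrightarrow> fst c \<in> states A \<and> snd c \<in> clocks A \<rightarrow> {0..}"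

definition initial_configuration :: "('a, 'q, 'x, 'p) ta \<Rightarrow> 'q \<times> ('x \<Rightarrow> real) \<Rightarrow> bool" where
  "initial_configuration A c \<longleftrightarrow> fst c = initial A \<and> (\<forall>x \<in> clocks A. snd c x = 0)"

text \<open>By choice, the two sequences of guards and reset sets in \<open>is_run\<close> can be
  replaced by a separate existential at each position. Being a run thus becomes a local condition on
  consecutive configurations.\<close>

lemma choice_pos_iff:
  "(\<exists>g S. \<forall>i>0. Q i (g i) (S i)) \<longleftrightarrow> (\<forall>i. \<exists>g S. Q (Suc i) g S)"
proof
  assume "\<forall>i. \<exists>g S. Q (Suc i) g S"
  then obtain g S where "\<And>i. Q (Suc i) (g i) (S i)"
    by metis
  \<comment> \<open>Positions of a word start at 1, whereas the chosen sequences start at 0.\<close>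
  then have "\<forall>i>0. Q i (g (i - 1)) (S (i - 1))"
    by (metis Suc_diff_1)
  then show "\<exists>g S. \<forall>i>0. Q i (g i) (S i)"
    by (intro exI[of _ "\<lambda>i. g (i - 1)"] exI[of _ "\<lambda>i. S (i - 1)"])
qed blast

lemma is_run_iff_steps:
  "is_run A I \<pi> \<tau> \<rho> \<longleftrightarrow>
     (\<forall>i. configuration A (\<rho> i)) \<and> initial_configuration A (\<rho> 0) \<and>
     (\<forall>i. step A I (\<pi> (Suc i)) (\<tau> (Suc i) - \<tau> i) (\<rho> i) (\<rho> (Suc i)))"
  using choice_pos_iff[where Q = "\<lambda>i g S.
        (fst (\<rho> (i - 1)), fst (\<rho> i), g, \<pi> i, S) \<in> transitions A \<and>
        sat (\<lambda>x. snd (\<rho> (i - 1)) x + (\<tau> i - \<tau> (i - 1))) I g \<and>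
        (\<forall>x \<in> clocks A. snd (\<rho> i) x =
           (if x \<in> S then 0 else snd (\<rho> (i - 1)) x + (\<tau> i - \<tau> (i - 1))))"]
  by (simp add: is_run_def Let_def step_def configuration_def initial_configuration_def)

text \<open>A finite union is infinite iff one of its members is. In this form acceptance transfers
  even though one Buechi state of \<open>A\<close> is split into many, one for each
  assignment.\<close>

lemma accepting_iff_infinite_visits:
  assumes "finite (buchi A)"
  shows "accepting A \<rho> \<longleftrightarrow> infinite {i. fst (\<rho> i) \<in> buchi A}"
proof -
  have "{i. fst (\<rho> i) \<in> buchi A} = (\<Union>b \<in> buchi A. {i. fst (\<rho> i) = b})"
    by auto
  then show ?thesis
    using assms by (simp add: accepting_def)
qed

text \<open>A run of \<open>B\<close> is built alongside the given run of \<open>A\<close>, one step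
  at a time. Steps need to be matched only for delays \<open>0 \<le> t\<close>, which keeps clock
  values nonnegative.\<close>

lemma language_subset_by_simulation:
  assumes alphabet: "alphabet A = alphabet B"
    and fin: "finite (buchi A)" "finite (buchi B)"
    and start: "\<And>c. initial_configuration A c \<Longrightarrow> \<exists>d. initial_configuration B d \<and> R c d"
    and step: "\<And>a t c c' d. 0 \<le> t \<Longrightarrow> R c d \<Longrightarrow> step A I a t c c' \<Longrightarrow>
                 \<exists>d'. step B I a t d d' \<and> R c' d'"
    and configuration: "\<And>c d. R c d \<Longrightarrow> configuration B d"
    and buchi: "\<And>c d. R c d \<Longrightarrow> fst c \<in> buchi A \<Longrightarrow> fst d \<in> buchi B"
  shows "language A I \<subseteq> language B I"
proof (clarsimp simp: language_def alphabet)
  fix \<pi> \<tau> \<rho>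
  assume word: "timed_word (alphabet B) \<pi> \<tau>" and run: "is_run A I \<pi> \<tau> \<rho>" and acc: "accepting A \<rho>"
  \<comment> \<open>The case \<open>i = 0\<close> is separate: the first time stamp may be 0, and
    strict growth is given only from position 1 on.\<close>
  have delay: "0 \<le> \<tau> (Suc i) - \<tau> i" for i
    using word by (cases i) (auto simp: timed_word_def less_imp_le)
  have run_step: "step A I (\<pi> (Suc i)) (\<tau> (Suc i) - \<tau> i) (\<rho> i) (\<rho> (Suc i))" for i
    using run by (simp add: is_run_iff_steps)
  \<comment> \<open>The clause for \<open>i = 0\<close> anchors the chosen sequence at an initial
    configuration, which \<open>R\<close> alone does not guarantee.\<close>
  have "\<exists>\<sigma>. \<forall>i. (R (\<rho> i) (\<sigma> i) \<and> (i = 0 \<longrightarrow> initial_configuration B (\<sigma> i))) \<and>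
               step B I (\<pi> (Suc i)) (\<tau> (Suc i) - \<tau> i) (\<sigma> i) (\<sigma> (Suc i))"
  proof (rule dependent_nat_choice)
    show "\<exists>d. R (\<rho> 0) d \<and> (0 = (0::nat) \<longrightarrow> initial_configuration B d)"
      using start[of "\<rho> 0"] run by (auto simp: is_run_iff_steps)
  next
    fix d i
    assume "R (\<rho> i) d \<and> (i = 0 \<longrightarrow> initial_configuration B d)"
    then show "\<exists>d'. (R (\<rho> (Suc i)) d' \<and> (Suc i = 0 \<longrightarrow> initial_configuration B d')) \<and>
                 step B I (\<pi> (Suc i)) (\<tau> (Suc i) - \<tau> i) d d'"
      using step[OF delay _ run_step] by blast
  qed
  then obtain \<sigma> where R: "\<And>i. R (\<rho> i) (\<sigma> i)" and init: "initial_configuration B (\<sigma> 0)"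
    and steps: "\<And>i. step B I (\<pi> (Suc i)) (\<tau> (Suc i) - \<tau> i) (\<sigma> i) (\<sigma> (Suc i))"
    by blast
  have "is_run B I \<pi> \<tau> \<sigma>"
    using init steps configuration[OF R] by (simp add: is_run_iff_steps)
  moreover have "{i. fst (\<rho> i) \<in> buchi A} \<subseteq> {i. fst (\<sigma> i) \<in> buchi B}"
    using R buchi by blast
  then have "accepting B \<sigma>"
    using acc fin by (auto simp: accepting_iff_infinite_visits dest: finite_subset)
  ultimately show "\<exists>\<sigma>. is_run B I \<pi> \<tau> \<sigma> \<and> accepting B \<sigma>"
    by blast
qed

section \<open>Renaming of clocks in guards, assignments of clocks to registers, and the register
  automaton\<close>

lemma sat_map_clocks:
  "sat v I (map_clock_constraint f id g) \<longleftrightarrow> sat (\<lambda>x. v (f x)) I g"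
  by (induction g) auto

lemma sat_cong:
  assumes "\<And>x. x \<in> constraint_clocks g \<Longrightarrow> v x = w x"
  shows "sat v I g \<longleftrightarrow> sat w I g"
  using assms by (induction g) auto

text \<open>Extensional functions make this set finite, so assignments can be part of a control
  state. Injectivity is not demanded: clocks with equal values may share a register.\<close>

definition assignments :: "'x set \<Rightarrow> ('x \<Rightarrow> nat) set" where
  "assignments X = X \<rightarrow>\<^sub>E {..card X}"

definition free_register :: "'x set \<Rightarrow> ('x \<Rightarrow> nat) \<Rightarrow> nat" where
  "free_register X m = (SOME k. k \<in> {..card X} - m ` X)"

text \<open>One register suffices for all of \<open>S\<close>, since these clocks agree after the
  reset and a later reset can separate them again. Restriction to \<open>X\<close> keeps the result
  extensional.\<close>

definition reassign :: "'x set \<Rightarrow> ('x \<Rightarrow> nat) \<Rightarrow> 'x set \<Rightarrow> 'x \<Rightarrow> nat" where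
  "reassign X m S = (\<lambda>x\<in>X. if x \<in> S then free_register X m else m x)"

text \<open>Pigeonhole: \<open>m\<close> occupies at most \<open>card X\<close> of the
  \<open>card X + 1\<close> registers.\<close>

lemma free_register:
  assumes "finite X"
  shows "free_register X m \<in> {..card X} - m ` X"
proof -
  have "card (m ` X) < card {..card X}"
    using card_image_le[OF assms, of m] by simp
  then have "{..card X} - m ` X \<noteq> {}"
    using assms by (metis Diff_eq_empty_iff card_mono finite_imageI not_less)
  then show ?thesis
    unfolding free_register_def by (rule some_in_eq[THEN iffD2])
qed

lemma finite_assignments: "finite X \<Longrightarrow> finite (assignments X)"
  by (auto simp: assignments_def intro: finite_PiE)

text \<open>This is the initial assignment: all clocks start at 0 and hence can share register
  0.\<close>

lemma zero_in_assignments: "(\<lambda>x\<in>X. 0) \<in> assignments X"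
  by (auto simp: assignments_def)

lemma reassign_in_assignments:
  assumes "finite X" "m \<in> assignments X"
  shows "reassign X m S \<in> assignments X"
  using assms free_register[of X m] by (auto simp: assignments_def reassign_def)

text \<open>The map \<open>e\<close> encodes a control state paired with an assignment of clocks to registers.\<close>

definition register_automaton ::
  "('q \<times> ('x \<Rightarrow> nat) \<Rightarrow> 'r) \<Rightarrow> ('a, 'q, 'x, 'p) ta \<Rightarrow> ('a, 'r, nat, 'p) ta" where
  "register_automaton e A =
     \<lparr>alphabet = alphabet A,
      clocks = {..card (clocks A)},
      states = e ` (states A \<times> assignments (clocks A)),
      transitions =
        (\<lambda>((q, q', g, a, S), m).
           (e (q, m), e (q', reassign (clocks A) m S), map_clock_constraint m id g, a,
            {free_register (clocks A) m})) ` (transitions A \<times> assignments (clocks A)),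
      initial = e (initial A, \<lambda>x\<in>clocks A. 0),
      buchi = e ` (buchi A \<times> assignments (clocks A)),
      params = params A\<rparr>"

lemma register_automaton_simps [simp]:
  "alphabet (register_automaton e A) = alphabet A"
  "clocks (register_automaton e A) = {..card (clocks A)}"
  "states (register_automaton e A) = e ` (states A \<times> assignments (clocks A))"
  "initial (register_automaton e A) = e (initial A, \<lambda>x\<in>clocks A. 0)"
  "buchi (register_automaton e A) = e ` (buchi A \<times> assignments (clocks A))"
  "params (register_automaton e A) = params A"
  by (simp_all add: register_automaton_def)

lemma register_transition_iff:
  "u \<in> transitions (register_automaton e A) \<longleftrightarrow>
     (\<exists>q q' g a S. \<exists>m \<in> assignments (clocks A). (q, q', g, a, S) \<in> transitions A \<and>
        u = (e (q, m), e (q', reassign (clocks A) m S), map_clock_constraint m id g, a,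
             {free_register (clocks A) m}))"
  by (force simp: register_automaton_def)

lemma timed_automaton_transitionD:
  assumes "timed_automaton A" "(q, q', g, a, S) \<in> transitions A"
  shows "q \<in> states A" "q' \<in> states A" "constraint_clocks g \<subseteq> clocks A"
    "constraint_params g \<subseteq> params A" "a \<in> alphabet A" "S \<subseteq> clocks A"
  using assms by (auto simp: timed_automaton_def constraints_def)

lemma timed_automaton_register_automaton:
  assumes "timed_automaton A"
  shows "timed_automaton (register_automaton e A)"
proof -
  have fin: "finite (clocks A)" "finite (assignments (clocks A))"
    using assms by (auto simp: timed_automaton_def intro: finite_assignments)
  have "finite (transitions (register_automaton e A))"
    using assms fin by (simp add: register_automaton_def timed_automaton_def)
  moreover have "transitions (register_automaton e A) \<subseteq>
      states (register_automaton e A) \<times> states (register_automaton e A) \<times>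
      constraints {..card (clocks A)} (params A) \<times> alphabet A \<times> Pow {..card (clocks A)}"
  proof
    fix u
    assume "u \<in> transitions (register_automaton e A)"
    then obtain q q' g a S m
      where m: "m \<in> assignments (clocks A)" and tr: "(q, q', g, a, S) \<in> transitions A"
        and u: "u = (e (q, m), e (q', reassign (clocks A) m S), map_clock_constraint m id g, a,
                     {free_register (clocks A) m})"
      by (auto simp: register_transition_iff)
    have "map_clock_constraint m id g \<in> constraints {..card (clocks A)} (params A)"
      using m timed_automaton_transitionD[OF assms tr]
      by (auto simp: constraints_def clock_constraint.set_map assignments_def)
    then show "u \<in> states (register_automaton e A) \<times> states (register_automaton e A) \<times>
        constraints {..card (clocks A)} (params A) \<times> alphabet A \<times> Pow {..card (clocks A)}"
      using m timed_automaton_transitionD[OF assms tr] free_register[OF fin(1), of m]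
        reassign_in_assignments[OF fin(1) m]
      by (auto simp: u)
  qed
  ultimately show ?thesis
    using assms fin zero_in_assignments[of "clocks A"]
    unfolding timed_automaton_def by auto
qed

text \<open>A renamed guard mentions only registers in the image of \<open>m\<close>, and the
  register being reset lies outside that image.\<close>

lemma nrt_register_automaton:
  assumes "timed_automaton A"
  shows "nrt (register_automaton e A)"
proof -
  have "free_register (clocks A) m \<notin> constraint_clocks (map_clock_constraint m id g)"
    if "(q, q', g, a, S) \<in> transitions A" for q q' g a S m
    using timed_automaton_transitionD(3)[OF assms that] free_register[of "clocks A" m] assms
    by (auto simp: clock_constraint.set_map timed_automaton_def)
  then show ?thesis
    by (auto simp: nrt_def register_transition_iff)
qed

section \<open>The simulation relation and the equality of languages\<close>

text \<open>This relation serves as a simulation in both directions. Nonnegativity is imposed on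
  every register, including those that hold no clock; for the clocks it follows, as each is read off
  a register.\<close>

definition holds_clocks ::
  "('q \<times> ('x \<Rightarrow> nat) \<Rightarrow> 'r) \<Rightarrow> ('a, 'q, 'x, 'p) ta \<Rightarrow>
   'q \<times> ('x \<Rightarrow> real) \<Rightarrow> 'r \<times> (nat \<Rightarrow> real) \<Rightarrow> bool" where
  "holds_clocks e A c d \<longleftrightarrow>
     fst c \<in> states A \<and> snd d \<in> {..card (clocks A)} \<rightarrow> {0..} \<and>
     (\<exists>m \<in> assignments (clocks A).
        fst d = e (fst c, m) \<and> (\<forall>x \<in> clocks A. snd c x = snd d (m x)))"

lemma holds_clocks_configuration:
  assumes "holds_clocks e A c d"
  shows "configuration A c" "configuration (register_automaton e A) d"
  using assms by (auto simp: holds_clocks_def configuration_def assignments_def)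

lemma sat_register_guard:
  assumes "timed_automaton A" "(q, q', g, a, S) \<in> transitions A"
    and "\<And>x. x \<in> clocks A \<Longrightarrow> v x = w (m x)"
  shows "sat (\<lambda>k. w k + t) I (map_clock_constraint m id g) \<longleftrightarrow> sat (\<lambda>x. v x + t) I g"
  unfolding sat_map_clocks using timed_automaton_transitionD(3)[OF assms(1,2)] assms(3)
  by (intro sat_cong) auto

text \<open>A clock in \<open>S\<close> now points to the register just set to 0. Any other clock
  keeps its register, which is occupied and therefore not the free one, so it has merely advanced by
  \<open>t\<close>.\<close>

lemma reassign_clock_value:
  assumes "finite X" "m \<in> assignments X" "x \<in> X" "v x = w (m x)"
    and "\<And>k. k \<le> card X \<Longrightarrow> w' k = (if k = free_register X m then 0 else w k + t)"
  shows "w' (reassign X m S x) = (if x \<in> S then 0 else v x + t)"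
proof -
  have "m x \<le> card X"
    using assms(2,3) by (auto simp: assignments_def)
  moreover have "m x \<noteq> free_register X m"
    using free_register[OF assms(1), of m] assms(3) by (metis DiffD2 image_eqI)
  ultimately show ?thesis
    using assms(3-5) free_register[OF assms(1), of m] by (simp add: reassign_def)
qed

lemma holds_clocks_forward:
  assumes ta: "timed_automaton A" and "0 \<le> t"
    and "holds_clocks e A c d" and "step A I a t c c'"
  shows "\<exists>d'. step (register_automaton e A) I a t d d' \<and> holds_clocks e A c' d'"
proof -
  let ?X = "clocks A"
  have fin: "finite ?X"
    using ta by (simp add: timed_automaton_def)
  obtain m where m: "m \<in> assignments ?X" and d: "fst d = e (fst c, m)"
    and eq: "\<And>x. x \<in> ?X \<Longrightarrow> snd c x = snd d (m x)" and nonneg: "snd d \<in> {..card ?X} \<rightarrow> {0..}"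
    using assms(3) by (auto simp: holds_clocks_def)
  obtain g S where tr: "(fst c, fst c', g, a, S) \<in> transitions A"
    and guard: "sat (\<lambda>x. snd c x + t) I g"
    and c': "\<And>x. x \<in> ?X \<Longrightarrow> snd c' x = (if x \<in> S then 0 else snd c x + t)"
    using assms(4) by (auto simp: step_def)
  \<comment> \<open>Registers evolve deterministically: all advance by \<open>t\<close>, except the
    free one, which is reset even if \<open>S\<close> is empty.\<close>
  define w where "w k = (if k = free_register ?X m then 0 else snd d k + t)" for k
  let ?d' = "(e (fst c', reassign ?X m S), w)"
  have "(fst d, fst ?d', map_clock_constraint m id g, a, {free_register ?X m})
      \<in> transitions (register_automaton e A)"
    unfolding register_transition_iff d
    by ((rule exI)+, rule bexI[OF _ m], rule conjI[OF tr]) simp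
  then have "step (register_automaton e A) I a t d ?d'"
    using guard
      sat_register_guard[where v = "snd c" and w = "snd d" and m = m and t = t and I = I,
        OF ta tr eq]
    unfolding step_def by (intro exI conjI) (auto simp: w_def)
  moreover have "w \<in> {..card ?X} \<rightarrow> {0..}"
    using nonneg \<open>0 \<le> t\<close> by (auto simp: w_def Pi_iff)
  then have "holds_clocks e A c' ?d'"
    using timed_automaton_transitionD(2)[OF ta tr] reassign_in_assignments[OF fin m]
      reassign_clock_value[where v = "snd c" and w = "snd d" and w' = w, OF fin m _ eq w_def] c'
    by (auto simp: holds_clocks_def intro!: bexI[of _ "reassign ?X m S"])
  ultimately show ?thesis
    by blast
qed

lemma holds_clocks_backward:
  assumes ta: "timed_automaton A" and "0 \<le> t"
    and inj: "inj_on e (states A \<times> assignments (clocks A))"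
    and "holds_clocks e A c d" and "step (register_automaton e A) I a t d d'"
  shows "\<exists>c'. step A I a t c c' \<and> holds_clocks e A c' d'"
proof -
  let ?X = "clocks A"
  have fin: "finite ?X"
    using ta by (simp add: timed_automaton_def)
  obtain m where m: "m \<in> assignments ?X" and d: "fst d = e (fst c, m)" and c: "fst c \<in> states A"
    and eq: "\<And>x. x \<in> ?X \<Longrightarrow> snd c x = snd d (m x)" and nonneg: "snd d \<in> {..card ?X} \<rightarrow> {0..}"
    using assms(4) by (auto simp: holds_clocks_def)
  obtain q q' g S n where n: "n \<in> assignments ?X" and tr0: "(q, q', g, a, S) \<in> transitions A"
    and source: "fst d = e (q, n)" and target: "fst d' = e (q', reassign ?X n S)"
    and guard: "sat (\<lambda>k. snd d k + t) I (map_clock_constraint n id g)"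
    and d': "\<And>k. k \<le> card ?X \<Longrightarrow>
               snd d' k = (if k = free_register ?X n then 0 else snd d k + t)"
    using assms(5) by (auto simp: step_def register_transition_iff)
  \<comment> \<open>The transition brings its own decoding of the state \<open>fst d\<close>;
    injectivity of \<open>e\<close> identifies it with the one from \<open>holds_clocks\<close>.
    Hence the free register and the guard are those belonging to \<open>m\<close>.\<close>
  have same: "q = fst c" "n = m"
    using inj_onD[OF inj, of "(q, n)" "(fst c, m)"] source d m n c
      timed_automaton_transitionD(1)[OF ta tr0] by auto
  have tr: "(fst c, q', g, a, S) \<in> transitions A"
    using tr0 same by simp
  \<comment> \<open>The reset set \<open>S\<close> is that of the transition of \<open>A\<close>
    from which the register transition arises.\<close>
  let ?c' = "(q', \<lambda>x. if x \<in> S then 0 else snd c x + t)"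
  have "step A I a t c ?c'"
    using tr guard
      sat_register_guard[where v = "snd c" and w = "snd d" and m = m and t = t and I = I,
        OF ta tr eq]
    unfolding step_def same by (intro exI conjI) auto
  moreover have "snd d' \<in> {..card ?X} \<rightarrow> {0..}"
    using nonneg \<open>0 \<le> t\<close> d' by (auto simp: Pi_iff)
  then have "holds_clocks e A ?c' d'"
    using timed_automaton_transitionD(2)[OF ta tr] reassign_in_assignments[OF fin m]
      reassign_clock_value[where v = "snd c" and w = "snd d" and w' = "snd d'",
        OF fin m _ eq d'[unfolded same]] target
    by (auto simp: holds_clocks_def same intro!: bexI[of _ "reassign ?X m S"])
  ultimately show ?thesis
    by blast
qed

text \<open>Each inclusion is a simulation, by \<open>holds_clocks\<close> and by its converse. In
  the converse direction injectivity of \<open>e\<close> decodes the states of the register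
  automaton.\<close>

lemma language_register_automaton:
  assumes ta: "timed_automaton A"
    and inj: "inj_on e (states A \<times> assignments (clocks A))"
  shows "language (register_automaton e A) I = language A I"
proof
  let ?B = "register_automaton e A"
  have fin: "finite (buchi A)" "finite (buchi ?B)"
    using ta by (auto simp: timed_automaton_def intro!: finite_assignments dest: finite_subset)
  have init: "initial A \<in> states A" and buchi: "buchi A \<subseteq> states A"
    using ta by (auto simp: timed_automaton_def)
  show "language A I \<subseteq> language ?B I"
  proof (rule language_subset_by_simulation[where R = "holds_clocks e A"])
    fix c
    assume "initial_configuration A c"
    then have "initial_configuration ?B (initial ?B, \<lambda>_. 0) \<and>
               holds_clocks e A c (initial ?B, \<lambda>_. 0)"
      using init zero_in_assignments
      by (auto simp: initial_configuration_def holds_clocks_def)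
    then show "\<exists>d. initial_configuration ?B d \<and> holds_clocks e A c d"
      by blast
  next
    show "fst d \<in> buchi ?B" if "holds_clocks e A c d" "fst c \<in> buchi A" for c d
      using that by (auto simp: holds_clocks_def)
  qed (use fin ta holds_clocks_forward holds_clocks_configuration in auto)
  show "language ?B I \<subseteq> language A I"
  proof (rule language_subset_by_simulation[where R = "\<lambda>d c. holds_clocks e A c d"])
    fix d
    assume "initial_configuration ?B d"
    \<comment> \<open>All registers of \<open>d\<close> are 0, so the zero valuation agrees with
      \<open>d\<close> through the assignment that is constantly 0 on the clocks.\<close>
    then have "initial_configuration A (initial A, \<lambda>_. 0) \<and>
               holds_clocks e A (initial A, \<lambda>_. 0) d"
      using init zero_in_assignments
      by (auto simp: initial_configuration_def holds_clocks_def
          intro!: bexI[of _ "\<lambda>x\<in>clocks A. 0"])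
    then show "\<exists>c. initial_configuration A c \<and> holds_clocks e A c d"
      by blast
  next
    show "fst c \<in> buchi A" if "holds_clocks e A c d" "fst d \<in> buchi ?B" for c d
      \<comment> \<open>The state \<open>fst d\<close> encodes \<open>fst c\<close> and also some
        state of \<open>buchi A\<close>; by injectivity these two coincide.\<close>
      using that buchi by (auto simp: holds_clocks_def dest!: inj_onD[OF inj])
  qed (use fin ta inj holds_clocks_backward holds_clocks_configuration in auto)
qed

theorem lemma1:
  fixes A :: "('a, 'q, 'x, 'p) ta"
  assumes "timed_automaton A"
  shows "\<exists>A' :: ('a, nat, nat, 'p) ta.
           timed_automaton A' \<and> nrt A' \<and> equivalent A A' \<and>
           card (clocks A') = card (clocks A) + 1"
proof -
  let ?S = "states A \<times> assignments (clocks A)"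
  \<comment> \<open>The required control states are natural numbers, so the finite set of pairs is
    numbered injectively. The clocks \<open>{..card (clocks A)}\<close> include 0, which gives the
    one extra clock.\<close>
  let ?B = "register_automaton (to_nat_on ?S) A"
  have "finite ?S"
    using assms by (auto simp: timed_automaton_def intro: finite_assignments)
  then have "inj_on (to_nat_on ?S) ?S"
    by (intro inj_on_to_nat_on countable_finite)
  then have "equivalent A ?B"
    unfolding equivalent_def using language_register_automaton[OF assms] by auto
  then show ?thesis
    using timed_automaton_register_automaton[OF assms, of "to_nat_on ?S"]
      nrt_register_automaton[OF assms, of "to_nat_on ?S"]
    by (intro exI[of _ ?B]) simp
qed

end
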